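(* Let $\mathcal{H}$ be a real Hilbert space, $J\in\mathcal{C}$, and let $(u,p)$ be the solution of the gradient flow of $J$ with initial datum $f$ satisfying $\bar f=0$. Assume that the flow generates a sequence of eigenvectors $p(t)$ for $t>0$, i.e. $p(t)\in\partial J(p(t))$ for all $t>0$, and has the minimal extinction time $0<T^*(f)<\infty$. Let $$w(t):=\begin{cases}\dfrac{u(t)}{T^*(f)-t},&0<t<T^*(f),\\ 0,&\text{else,}\end{cases}$$ and let $p^*\in\mathcal{H}$ be such that $w(t_n)\rightharpoonup p^*$ weakly in $\mathcal{H}$, where $(t_n)$ is an increasing sequence converging to $T^*(f)$ as $n\to\infty$, with $t_n<T^*(f)$. Then the following statements are true: 1. If there is $C>0$ such that $\|u(t)-\bar f\|\le C\,J(u(t))$ for all $t>0$, then $p^*\ne0$. 2. $p(t)\in\partial J(p^* )$ for all $0<t<T^*(f)$. 3. $p^*\in\partial J(p^* )$. 4. $T^*(f)=\dfrac{\langle f,p^*\rangle}{J(p^* )}=\sup_{p\in\mathcal{N}(J)^\perp}\dfrac{\langle f,p\rangle}{J(p)}$.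
   Context: The Hilbert space $\mathcal{H}$ has inner product $\langle\cdot,\cdot\rangle$ and induced norm $\|\cdot\|$. The class $\mathcal{C}$ consists of all maps $J:\mathcal{H}\to\mathbb{R}\cup\{+\infty\}$ that are convex, lower semicontinuous with respect to the strong topology of $\mathcal{H}$, and absolutely one-homogeneous, i.e. $J(cu)=|c|J(u)$ for all $u\in\mathcal{H}$, $c\in\mathbb{R}\setminus\{0\}$, and $J(0)=0$. The subdifferential is $\partial J(u)=\{p\in\mathcal{H}:\langle p,v\rangle\le J(v)\ \forall v\in\mathcal{H},\ \langle p,u\rangle=J(u)\}$, and $\mathrm{dom}(\partial J)=\{u\in\mathcal{H}:\partial J(u)\ne\emptyset\}$. $\mathcal{N}(J)=\{u\in\mathcal{H}:J(u)=0\}$ is a closed linear space with orthogonal complement $\mathcal{N}(J)^\perp$, and $\bar f$ is the orthogonal projection of $f$ onto $\mathcal{N}(J)$. The extinction time is $T^*(f):=\inf\{t>0:u(t)=\bar f\}$. Gradient flow: for $f\in\overline{\mathrm{dom}(\partial J)}$, the solution $(u,p)$ of $\partial_tu(t)=-p(t)$, $p(t)\in\partial J(u(t))$, $u(0)=f$ is the unique continuous $u:[0,\infty)\to\mathcal{H}$ with $u(0)=f$ given by Brezis' theory (Lipschitz on $[\delta,\infty)$ for every $\delta>0$, $u(t)\in\mathrm{dom}(\partial J)$ for all $t>0$, right-differentiable at every $t>0$), together with $p(t):=-\partial_t^+u(t)$ (right derivative), which is the element of minimal norm in $\partial J(u(t))$ for every $t>0$.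
   Formalization: The first equality in item 4, T*(f) = ⟨f,p*⟩/J(p* ), is stated only for p* ≠ 0 (p* = 0 can occur without the condition of item 1, and the quotient is then 0/0), and the supremum runs over nonzero p in N(J)^⊥. *)

theory Defs
  imports "HOL-Analysis.Analysis"
begin

text \<open>Functionals with values in \<open>\<real> \<union> {+\<infinity>}\<close> are represented as \<^typ>\<open>ereal\<close>-valued
  functions that never take the value \<open>-\<infinity>\<close>. A real Hilbert space is a type of class
  \<open>{real_inner, complete_space}\<close>.\<close>

definition convex_ereal :: "('a::real_vector \<Rightarrow> ereal) \<Rightarrow> bool" where
  "convex_ereal J \<longleftrightarrow>
     (\<forall>u v. \<forall>l\<in>{0..1}. J ((1 - l) *\<^sub>R u + l *\<^sub>R v) \<le> ereal (1 - l) * J u + ereal l * J v)"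

definition lower_semicontinuous :: "('a::topological_space \<Rightarrow> ereal) \<Rightarrow> bool" where
  "lower_semicontinuous J \<longleftrightarrow> (\<forall>u. \<forall>a < J u. \<forall>\<^sub>F v in nhds u. a < J v)"

definition absolutely_one_homogeneous :: "('a::real_vector \<Rightarrow> ereal) \<Rightarrow> bool" where
  "absolutely_one_homogeneous J \<longleftrightarrow>
     (\<forall>u c. c \<noteq> 0 \<longrightarrow> J (c *\<^sub>R u) = ereal \<bar>c\<bar> * J u) \<and> J 0 = 0"

definition functional_class :: "('a::real_inner \<Rightarrow> ereal) set" where
  "functional_class = {J. (\<forall>u. J u \<noteq> -\<infinity>) \<and> convex_ereal J \<and> lower_semicontinuous J
                          \<and> absolutely_one_homogeneous J}"

definition subdiff :: "('a::real_inner \<Rightarrow> ereal) \<Rightarrow> 'a \<Rightarrow> 'a set" where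
  "subdiff J u = {p. (\<forall>v. ereal (p \<bullet> v) \<le> J v) \<and> ereal (p \<bullet> u) = J u}"

definition dom_subdiff :: "('a::real_inner \<Rightarrow> ereal) \<Rightarrow> 'a set" where
  "dom_subdiff J = {u. subdiff J u \<noteq> {}}"

definition null_space :: "('a::real_inner \<Rightarrow> ereal) \<Rightarrow> 'a set" where
  "null_space J = {u. J u = 0}"

text \<open>The library's \<^const>\<open>closest_point\<close> requires a Heine--Borel space, so it is not available in
  infinite dimensions.\<close>

definition orthogonal_projection :: "'a::real_inner set \<Rightarrow> 'a \<Rightarrow> 'a" where
  "orthogonal_projection S f = (THE y. y \<in> S \<and> f - y \<in> S\<^sup>\<bottom>)"

abbreviation null_proj :: "('a::real_inner \<Rightarrow> ereal) \<Rightarrow> 'a \<Rightarrow> 'a" where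
  "null_proj J f \<equiv> orthogonal_projection (null_space J) f"

text \<open>\<open>(u, p)\<close> is the solution of \<open>\<partial>\<^sub>t u = -p\<close>, \<open>p \<in> \<partial>J(u)\<close>, \<open>u(0) = f\<close> in the sense of
  Brezis. The values of \<open>u\<close> at negative times and of \<open>p\<close> at nonpositive times are irrelevant.\<close>

definition gradient_flow ::
    "('a::real_inner \<Rightarrow> ereal) \<Rightarrow> 'a \<Rightarrow> (real \<Rightarrow> 'a) \<Rightarrow> (real \<Rightarrow> 'a) \<Rightarrow> bool" where
  "gradient_flow J f u p \<longleftrightarrow>
     continuous_on {0..} u \<and> u 0 = f \<and>
     (\<forall>\<delta>>0. \<exists>L. lipschitz_on L {\<delta>..} u) \<and>
     (\<forall>t>0. u t \<in> dom_subdiff J \<and>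
            (u has_vector_derivative - p t) (at_right t) \<and>
            is_arg_min norm (\<lambda>q. q \<in> subdiff J (u t)) (p t))"

text \<open>The infimum is taken in the extended reals, so that it is \<open>\<infinity>\<close> if there is no extinction.\<close>

definition extinction_time :: "('a::real_inner \<Rightarrow> ereal) \<Rightarrow> 'a \<Rightarrow> (real \<Rightarrow> 'a) \<Rightarrow> ereal" where
  "extinction_time J f u = Inf (ereal ` {t. 0 < t \<and> u t = null_proj J f})"

definition extinction_profile :: "real \<Rightarrow> (real \<Rightarrow> 'a::real_vector) \<Rightarrow> real \<Rightarrow> 'a" where
  "extinction_profile T u t = (if 0 < t \<and> t < T then u t /\<^sub>R (T - t) else 0)"

definition weakly_converges_to :: "(nat \<Rightarrow> 'a::real_inner) \<Rightarrow> 'a \<Rightarrow> bool" where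
  "weakly_converges_to x l \<longleftrightarrow> (\<forall>v. (\<lambda>n. x n \<bullet> v) \<longlonglongrightarrow> l \<bullet> v)"

end

theory Submission
  imports Defs
begin

text \<open>The flow is the solution of \<open>u' = - p\<close> in the sense of right derivatives, so \<open>u t\<close> is,
  up to the vanishing value \<open>u T = 0\<close>, the integral of \<open>p\<close> over \<open>[t, T]\<close>. Integrals of vector-valued
  functions are replaced throughout by the mean value inequality \<open>increment_le_if_right_derivative_le\<close>
  for the scalar functions \<open>u r \<bullet> v\<close>, whose right derivative is \<open>- (p r \<bullet> v)\<close>.

  The heart of the proof is \<open>functional_linear_along_flow\<close>: if \<open>t \<le> s\<close>, the earlier velocity \<open>p t\<close>
  is still a subgradient of \<open>J\<close> at \<open>u s\<close>, that is, \<open>J (u s) = p t \<bullet> u s\<close>. The gap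
  \<open>J (u s) - p t \<bullet> u s\<close> is nonnegative and vanishes at \<open>s = t\<close>. Its slope is
  \<open>- (p s \<bullet> p s) + p t \<bullet> p s\<close>, and since \<open>p t\<close> is dominated by \<open>J\<close> and \<open>p s\<close> is an eigenvector,
  \<open>p t \<bullet> p s \<le> J (p s) = p s \<bullet> p s\<close>. So the gap cannot grow. Differentiating the resulting identity
  gives \<open>p t \<bullet> p s = p s \<bullet> p s\<close> for \<open>t \<le> s\<close>.

  On the profiles \<open>w s = u s / (T - s)\<close> the functional is therefore given by one fixed linear form,
  \<open>J (w s) = p t \<bullet> w s\<close> for all \<open>s \<ge> t\<close>, and the right-hand side converges along a weakly convergent
  sequence. Since a convex lower semicontinuous functional is weakly lower semicontinuous, the limit
  satisfies \<open>J pstar = p t \<bullet> pstar\<close>, which is the second claim. Integrating this over \<open>[s, T]\<close> gives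
  \<open>u s \<bullet> pstar = (T - s) J pstar\<close>. Applied to \<open>w (s n)\<close> in the limit this shows
  \<open>pstar \<bullet> pstar = J pstar\<close>, and for \<open>s = 0\<close> it is the quotient formula for \<open>T\<close>. That \<open>pstar\<close> is
  dominated by \<open>J\<close> holds because \<open>w s\<close> is an average of the velocities, all of which are.

  The same averaging bounds every quotient in the supremum by \<open>T\<close>. The supremum is approached by the
  velocities \<open>p t\<close> with \<open>t \<rightarrow> T\<close>: they give a quotient of at least \<open>t\<close>, whether or not \<open>pstar\<close>
  vanishes. Finally, the coercivity inequality in the first claim bounds \<open>p\<close> from below in norm, so
  \<open>p t \<bullet> w s\<close>, an average of \<open>p r \<bullet> p r\<close>, stays away from zero.\<close>

section \<open>Monotonicity from one-sided derivatives\<close>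

text \<open>Fix a slope \<open>e > 0\<close> and a point \<open>c\<close>. The last point at which \<open>g\<close> lies on or below the line of
  slope \<open>e\<close> through \<open>(c, g c)\<close> must be the right end point, because from any other point the
  hypothesis leads further to the right. The hypothesis asks for arbitrarily small steps that work,
  not for all small steps, and it is imposed only in the interior: \<open>a\<close> is reached by continuity.\<close>

lemma nonincreasing_if_lower_right_dini_nonpos:
  fixes g :: "real \<Rightarrow> real"
  assumes "a \<le> b" and cont: "continuous_on {a..b} g"
    and dini: "\<And>x e d. a < x \<Longrightarrow> x < b \<Longrightarrow> 0 < e \<Longrightarrow> 0 < d
                 \<Longrightarrow> \<exists>h. 0 < h \<and> h < d \<and> g (x + h) \<le> g x + e * h"
  shows "g b \<le> g a"
proof -
  have slope: "g b \<le> g c + e * (b - c)" if c: "a < c" "c \<le> b" and "0 < e" for c e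
  proof -
    define S where "S = {x \<in> {c..b}. g x - e * x \<le> g c - e * c}"
    have "continuous_on {c..b} (\<lambda>x. g x - e * x)"
      using c continuous_on_subset[OF cont, of "{c..b}"] by (auto intro!: continuous_intros)
    then have "closed S"
      unfolding S_def by (rule continuous_on_closed_Collect_le) (intro continuous_intros closed_atLeastAtMost)+
    then have "compact S"
      unfolding compact_eq_bounded_closed
      by (auto simp: S_def intro!: bounded_subset[OF bounded_closed_interval[of c b]])
    moreover have "c \<in> S" using c by (auto simp: S_def)
    ultimately obtain m where m: "m \<in> S" "\<And>x. x \<in> S \<Longrightarrow> x \<le> m"
      using compact_attains_sup[of S] by auto
    have "m = b"
    proof (rule ccontr)
      assume "m \<noteq> b"
      then have "a < m" "m < b" using m(1) c by (auto simp: S_def)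
      then obtain h where "0 < h" "h < b - m" "g (m + h) \<le> g m + e * h"
        using dini[of m e "b - m"] \<open>0 < e\<close> by auto
      then have "m + h \<in> S" using m(1) by (auto simp: S_def algebra_simps)
      then show False using m(2) \<open>0 < h\<close> by fastforce
    qed
    then show ?thesis using m(1) by (auto simp: S_def algebra_simps)
  qed
  have inner: "g b \<le> g c" if "a < c" "c \<le> b" for c
  proof (rule field_le_epsilon)
    fix e :: real assume "0 < e"
    have "e / (b - c + 1) * (b - c) \<le> e"
      using \<open>0 < e\<close> that by (simp add: field_simps)
    then show "g b \<le> g c + e"
      using slope[OF that, of "e / (b - c + 1)"] \<open>0 < e\<close> that by auto
  qed
  show ?thesis
  proof (cases "a = b")
    case False
    then have "a < b" using \<open>a \<le> b\<close> by simp
    have "(g \<longlongrightarrow> g a) (at_right a)"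
      using cont \<open>a < b\<close> continuous_on_Icc_at_rightD by blast
    moreover have "\<forall>\<^sub>F c in at_right a. g b \<le> g c"
      using eventually_at_right_real[OF \<open>a < b\<close>] by eventually_elim (auto intro!: inner)
    ultimately show ?thesis
      by (intro tendsto_lowerbound[of g "g a" "at_right a"]) auto
  qed simp
qed

lemma increment_le_if_right_derivative_le:
  fixes g g' :: "real \<Rightarrow> real"
  assumes "a \<le> b" and cont: "continuous_on {a..b} g"
    and deriv: "\<And>x. a < x \<Longrightarrow> x < b \<Longrightarrow> (g has_real_derivative g' x) (at_right x)"
    and bound: "\<And>x. a < x \<Longrightarrow> x < b \<Longrightarrow> g' x \<le> c"
  shows "g b - g a \<le> c * (b - a)"
proof -
  have "g b - c * b \<le> g a - c * a"
  proof (rule nonincreasing_if_lower_right_dini_nonpos[OF \<open>a \<le> b\<close>])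
    show "continuous_on {a..b} (\<lambda>x. g x - c * x)" by (intro continuous_intros cont)
    fix x e d :: real assume x: "a < x" "x < b" and "0 < e" "0 < d"
    have "((\<lambda>y. (g y - g x) / (y - x)) \<longlongrightarrow> g' x) (at_right x)"
      using deriv[OF x] by (simp add: has_field_derivative_iff)
    then have "\<forall>\<^sub>F y in at_right x. (g y - g x) / (y - x) < c + e"
      using bound[OF x] \<open>0 < e\<close> by (intro order_tendstoD(2)) auto
    moreover have "\<forall>\<^sub>F y in at_right x. y \<in> {x<..<x + d}"
      using \<open>0 < d\<close> by (intro eventually_at_right_real) auto
    ultimately have "\<forall>\<^sub>F y in at_right x. y \<in> {x<..<x + d} \<and> (g y - g x) / (y - x) < c + e"
      by eventually_elim auto
    then obtain y where "y \<in> {x<..<x + d}" "(g y - g x) / (y - x) < c + e"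
      using eventually_happens'[OF trivial_limit_at_right_real] by blast
    then show "\<exists>h. 0 < h \<and> h < d \<and> g (x + h) - c * (x + h) \<le> g x - c * x + e * h"
      by (intro exI[of _ "y - x"]) (auto simp: field_simps)
  qed
  then show ?thesis by (simp add: algebra_simps)
qed

section \<open>Nearest points in Hilbert space\<close>

text \<open>A minimizing sequence is Cauchy by the parallelogram identity, since midpoints stay in \<open>C\<close>.
  Moving from the minimizer towards \<open>v\<close> cannot decrease the distance, which is the variational
  inequality.\<close>

lemma nearest_point_exists:
  fixes C :: "'a::{real_inner, complete_space} set"
  assumes "convex C" "closed C" "C \<noteq> {}"
  obtains z where "z \<in> C" "\<And>v. v \<in> C \<Longrightarrow> (x - z) \<bullet> (v - z) \<le> 0"
proof -
  define d where "d = (INF v\<in>C. (norm (x - v))\<^sup>2)"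
  have bdd: "bdd_below ((\<lambda>v. (norm (x - v))\<^sup>2) ` C)" by (rule bdd_belowI2[of _ 0]) auto
  have lower: "d \<le> (norm (x - v))\<^sup>2" if "v \<in> C" for v
    unfolding d_def using bdd that by (rule cINF_lower)
  have "\<exists>v\<in>C. (norm (x - v))\<^sup>2 < d + inverse (real (Suc n))" for n
  proof -
    have "d < d + inverse (real (Suc n))" by simp
    then show ?thesis unfolding d_def using cINF_less_iff[OF assms(3) bdd] by blast
  qed
  then obtain y where y: "\<And>n. y n \<in> C" "\<And>n. (norm (x - y n))\<^sup>2 < d + inverse (real (Suc n))"
    by metis
  have close: "(norm (y m - y n))\<^sup>2 \<le> 2 * inverse (real (Suc m)) + 2 * inverse (real (Suc n))" for m n
  proof -
    have "(1/2) *\<^sub>R y m + (1/2) *\<^sub>R y n \<in> C"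
      using convexD[OF assms(1) y(1)[of m] y(1)[of n], of "1/2" "1/2"] by simp
    from lower[OF this] have "4 * d \<le> 4 * (norm (x - ((1/2) *\<^sub>R y m + (1/2) *\<^sub>R y n)))\<^sup>2" by simp
    also have "\<dots> = 2 * (norm (x - y m))\<^sup>2 + 2 * (norm (x - y n))\<^sup>2 - (norm (y m - y n))\<^sup>2"
      unfolding power2_norm_eq_inner
      by (simp add: inner_diff_left inner_diff_right inner_add_left inner_add_right inner_commute algebra_simps)
    finally show ?thesis using y(2)[of m] y(2)[of n] by linarith
  qed
  have "Cauchy y"
  proof (rule metric_CauchyI)
    fix e :: real assume "0 < e"
    obtain M where M: "inverse (real (Suc M)) < e\<^sup>2 / 4"
      using reals_Archimedean[of "e\<^sup>2 / 4"] \<open>0 < e\<close> by auto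
    have "dist (y m) (y n) < e" if "M \<le> m" "M \<le> n" for m n
    proof -
      have "inverse (real (Suc m)) \<le> inverse (real (Suc M))" "inverse (real (Suc n)) \<le> inverse (real (Suc M))"
        using that by (auto intro!: le_imp_inverse_le)
      then have "(norm (y m - y n))\<^sup>2 < e\<^sup>2" using close[of m n] M by linarith
      then show ?thesis unfolding dist_norm using \<open>0 < e\<close> by (intro power_less_imp_less_base[of _ 2 e]) auto
    qed
    then show "\<exists>M. \<forall>m\<ge>M. \<forall>n\<ge>M. dist (y m) (y n) < e" by blast
  qed
  then obtain z where z: "y \<longlonglongrightarrow> z" using Cauchy_convergent_iff convergent_def by blast
  have "z \<in> C" using closed_sequentially[OF assms(2) _ z] y(1) by blast
  have "(norm (x - z))\<^sup>2 \<le> d"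
  proof (rule LIMSEQ_le)
    show "(\<lambda>n. (norm (x - y n))\<^sup>2) \<longlonglongrightarrow> (norm (x - z))\<^sup>2" by (intro tendsto_intros z)
    show "(\<lambda>n. d + inverse (real (Suc n))) \<longlonglongrightarrow> d"
      using tendsto_add[OF tendsto_const LIMSEQ_inverse_real_of_nat, of d] by simp
    show "\<exists>N. \<forall>n\<ge>N. (norm (x - y n))\<^sup>2 \<le> d + inverse (real (Suc n))" using y(2) less_imp_le by blast
  qed
  have "(x - z) \<bullet> (v - z) \<le> 0" if "v \<in> C" for v
  proof (rule ccontr)
    assume "\<not> ?thesis"
    then have pos: "0 < (x - z) \<bullet> (v - z)" by simp
    \<comment> \<open>The unconstrained minimizer of the distance on the line through \<open>z\<close> and \<open>v\<close>, cut off at \<open>v\<close>.\<close>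
    define l where "l = min 1 (((x - z) \<bullet> (v - z)) / ((norm (v - z))\<^sup>2))"
    have "v \<noteq> z" using pos by auto
    then have nz: "0 < (norm (v - z))\<^sup>2" by simp
    have l: "0 < l" "l \<le> 1" using pos nz by (auto simp: l_def)
    have "l \<le> ((x - z) \<bullet> (v - z)) / ((norm (v - z))\<^sup>2)" by (simp add: l_def)
    then have lb: "l * (norm (v - z))\<^sup>2 \<le> (x - z) \<bullet> (v - z)" using nz by (simp add: field_simps)
    have "(1 - l) *\<^sub>R z + l *\<^sub>R v \<in> C" using convexD[OF assms(1) \<open>z \<in> C\<close> that, of "1 - l" l] l by simp
    from lower[OF this] have "d \<le> (norm (x - ((1 - l) *\<^sub>R z + l *\<^sub>R v)))\<^sup>2" .
    also have "x - ((1 - l) *\<^sub>R z + l *\<^sub>R v) = (x - z) - l *\<^sub>R (v - z)" by (simp add: algebra_simps)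
    also have "(norm ((x - z) - l *\<^sub>R (v - z)))\<^sup>2
        = (norm (x - z))\<^sup>2 - 2 * (l * ((x - z) \<bullet> (v - z))) + l * (l * (norm (v - z))\<^sup>2)"
      unfolding power2_norm_eq_inner
      by (simp add: inner_diff_left[of "x - z" "l *\<^sub>R (v - z)"] inner_diff_right[of _ "x - z" "l *\<^sub>R (v - z)"] inner_commute[of "v - z" "x - z"] right_diff_distrib)
    also have "l * (l * (norm (v - z))\<^sup>2) \<le> l * ((x - z) \<bullet> (v - z))"
      using lb l by (intro mult_left_mono) auto
    finally have "d \<le> (norm (x - z))\<^sup>2 - l * ((x - z) \<bullet> (v - z))" by simp
    moreover have "0 < l * ((x - z) \<bullet> (v - z))" using l pos by simp
    ultimately show False using \<open>(norm (x - z))\<^sup>2 \<le> d\<close> by linarith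
  qed
  then show thesis using that \<open>z \<in> C\<close> by blast
qed

section \<open>One-homogeneous convex functionals\<close>

lemma functional_classD:
  assumes "J \<in> functional_class"
  shows "J v \<noteq> -\<infinity>" and "J 0 = 0"
    and "c \<noteq> 0 \<Longrightarrow> J (c *\<^sub>R v) = ereal \<bar>c\<bar> * J v"
    and "0 \<le> l \<Longrightarrow> l \<le> 1 \<Longrightarrow> J ((1 - l) *\<^sub>R v + l *\<^sub>R w) \<le> ereal (1 - l) * J v + ereal l * J w"
  using assms unfolding functional_class_def convex_ereal_def absolutely_one_homogeneous_def
  by simp_all

lemma functional_class_nonneg:
  assumes "J \<in> functional_class"
  shows "0 \<le> J v"
proof (rule ccontr)
  assume neg: "\<not> 0 \<le> J v"
  \<comment> \<open>The origin is the midpoint of \<open>v\<close> and \<open>- v\<close>, where \<open>J\<close> takes the same value.\<close>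
  have hom: "J (- v) = J v" "J 0 = 0"
    using functional_classD(3)[OF assms, of "-1" v] functional_classD(2)[OF assms]
    by (simp_all flip: one_ereal_def)
  have "J ((1 - 1/2) *\<^sub>R v + (1/2) *\<^sub>R (- v)) \<le> ereal (1 - 1/2) * J v + ereal (1/2) * J (- v)"
    by (rule functional_classD(4)[OF assms]) simp_all
  then have "0 \<le> ereal (1/2) * J v + ereal (1/2) * J v" using hom by simp
  moreover have "J v \<noteq> -\<infinity>" by (rule functional_classD(1)[OF assms])
  ultimately show False using neg by (cases "J v") auto
qed

lemma functional_class_sublevel_convex:
  assumes "J \<in> functional_class"
  shows "convex {v. J v \<le> ereal a}"
proof (rule convexI)
  fix v w :: 'a and l m :: real
  assume v: "v \<in> {v. J v \<le> ereal a}" and w: "w \<in> {v. J v \<le> ereal a}"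
    and lm: "0 \<le> l" "0 \<le> m" "l + m = 1"
  have "J ((1 - m) *\<^sub>R v + m *\<^sub>R w) \<le> ereal (1 - m) * J v + ereal m * J w"
    using lm by (intro functional_classD(4)[OF assms]) simp_all
  also have "\<dots> \<le> ereal (1 - m) * ereal a + ereal m * ereal a"
    using v w lm by (intro add_mono ereal_mult_left_mono) auto
  also have "\<dots> = ereal a" by (simp add: algebra_simps)
  also have "1 - m = l" using lm by simp
  finally show "l *\<^sub>R v + m *\<^sub>R w \<in> {v. J v \<le> ereal a}" by simp
qed

lemma functional_class_sublevel_closed:
  assumes "J \<in> functional_class"
  shows "closed {v. J v \<le> ereal a}"
proof -
  have "\<exists>S. open S \<and> v \<in> S \<and> S \<subseteq> {v. ereal a < J v}" if "ereal a < J v" for v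
  proof -
    have "\<forall>\<^sub>F w in nhds v. ereal a < J w"
      using assms that by (simp add: functional_class_def lower_semicontinuous_def)
    then show ?thesis unfolding eventually_nhds by blast
  qed
  then have "open {v. ereal a < J v}" by (subst open_subopen) simp
  moreover have "- {v. J v \<le> ereal a} = {v. ereal a < J v}" by auto
  ultimately show ?thesis by (simp add: closed_def)
qed

text \<open>Sublevel sets of \<open>J\<close> are closed and convex, hence weakly closed: if the weak limit \<open>l\<close> had a
  nearest point \<open>z \<noteq> l\<close> in the sublevel set, the functional \<open>(l - z) \<bullet> _\<close> would separate \<open>l\<close> strictly
  from the sequence.\<close>

lemma functional_class_weak_lower_bound:
  fixes J :: "'a::{real_inner, complete_space} \<Rightarrow> ereal"
  assumes "J \<in> functional_class" "weakly_converges_to x l"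
    and "\<forall>\<^sub>F n in sequentially. J (x n) = ereal (c n)" "c \<longlonglongrightarrow> a"
  shows "J l \<le> ereal a"
proof (rule ereal_le_epsilon2)
  fix e :: real assume "0 < e"
  define C where "C = {v. J v \<le> ereal (a + e)}"
  have "\<forall>\<^sub>F n in sequentially. c n < a + e" using assms(4) \<open>0 < e\<close> by (intro order_tendstoD(2)) auto
  then have inC: "\<forall>\<^sub>F n in sequentially. x n \<in> C"
    using assms(3) by eventually_elim (simp add: C_def)
  then have "C \<noteq> {}" by (auto simp: eventually_sequentially)
  then obtain z where z: "z \<in> C" "\<And>v. v \<in> C \<Longrightarrow> (l - z) \<bullet> (v - z) \<le> 0"
    using nearest_point_exists[of C l] functional_class_sublevel_convex[OF assms(1)]
      functional_class_sublevel_closed[OF assms(1)] unfolding C_def by blast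
  have "(\<lambda>n. x n \<bullet> (l - z)) \<longlonglongrightarrow> l \<bullet> (l - z)" using assms(2) unfolding weakly_converges_to_def by blast
  moreover have "\<forall>\<^sub>F n in sequentially. x n \<bullet> (l - z) \<le> z \<bullet> (l - z)"
    using inC
  proof eventually_elim
    case (elim n)
    then show ?case using z(2)[of "x n"] by (simp add: inner_diff_left inner_diff_right inner_commute)
  qed
  ultimately have "l \<bullet> (l - z) \<le> z \<bullet> (l - z)" by (intro tendsto_upperbound) auto
  then have "(l - z) \<bullet> (l - z) \<le> 0" by (simp add: inner_diff_left)
  then have "l = z" by (metis inner_eq_zero_iff inner_ge_zero order_antisym right_minus_eq)
  then show "J l \<le> ereal a + ereal e" using z(1) by (simp add: C_def)
qed

lemma null_space_eq_sublevel:
  assumes "J \<in> functional_class"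
  shows "null_space J = {v. J v \<le> ereal 0}"
  using functional_class_nonneg[OF assms] by (auto simp: null_space_def zero_ereal_def intro: antisym)

lemma null_space_subspace:
  assumes "J \<in> functional_class"
  shows "subspace (null_space J)"
proof -
  note eq = null_space_eq_sublevel[OF assms]
  have hom: "J 0 = 0" "c \<noteq> 0 \<Longrightarrow> J (c *\<^sub>R v) = ereal \<bar>c\<bar> * J v" for c v
    using functional_classD(2,3)[OF assms] by blast+
  have scale: "c *\<^sub>R v \<in> null_space J" if "v \<in> null_space J" for c v
    using that hom by (cases "c = 0") (auto simp: null_space_def)
  have "v + w \<in> null_space J" if "v \<in> null_space J" "w \<in> null_space J" for v w
  proof -
    have "(1/2) *\<^sub>R v + (1/2) *\<^sub>R w \<in> null_space J"
      using that unfolding eq by (intro convexD[OF functional_class_sublevel_convex[OF assms]]) auto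
    from scale[OF this, of 2] show ?thesis by (simp add: scaleR_add_right)
  qed
  then show ?thesis unfolding subspace_def using scale hom by (auto simp: null_space_def)
qed

lemma null_space_closed:
  assumes "J \<in> functional_class"
  shows "closed (null_space J)"
  unfolding null_space_eq_sublevel[OF assms] by (rule functional_class_sublevel_closed[OF assms])

text \<open>The description operator in \<^const>\<open>orthogonal_projection\<close> carries information only once existence
  and uniqueness are known. Existence is the nearest point, for which the variational inequality, used
  in both directions along the subspace, becomes orthogonality.\<close>

lemma orthogonal_projection_properties:
  fixes S :: "'a::{real_inner, complete_space} set"
  assumes "subspace S" "closed S"
  shows "orthogonal_projection S f \<in> S \<and> f - orthogonal_projection S f \<in> S\<^sup>\<bottom>"
proof -
  obtain z where z: "z \<in> S" "\<And>v. v \<in> S \<Longrightarrow> (f - z) \<bullet> (v - z) \<le> 0"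
    using nearest_point_exists[OF subspace_imp_convex[OF assms(1)] assms(2), of f] subspace_0[OF assms(1)] by blast
  have "(f - z) \<bullet> v = 0" if "v \<in> S" for v
    using z(2)[of "z + v"] z(2)[of "z - v"] subspace_add[OF assms(1) z(1) that]
      subspace_diff[OF assms(1) z(1) that] by simp
  then have ex: "z \<in> S \<and> f - z \<in> S\<^sup>\<bottom>"
    using z(1) by (simp add: orthogonal_comp_def orthogonal_def inner_commute)
  have "y = z" if "y \<in> S \<and> f - y \<in> S\<^sup>\<bottom>" for y
  proof -
    have "z - y \<in> S" using that z(1) assms(1) by (simp add: subspace_diff)
    then have "(z - y) \<bullet> (f - y) = 0" "(z - y) \<bullet> (f - z) = 0"
      using that ex by (auto simp: orthogonal_comp_def orthogonal_def)
    then have "(z - y) \<bullet> (z - y) = 0" by (simp add: inner_diff_right)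
    then show ?thesis by simp
  qed
  then show ?thesis unfolding orthogonal_projection_def using theI'[of "\<lambda>y. y \<in> S \<and> f - y \<in> S\<^sup>\<bottom>"] ex by blast
qed

text \<open>A linear form dominated by \<open>J\<close> is nonpositive on the linear space on which \<open>J\<close> vanishes, hence zero
  there.\<close>

lemma subgradient_orthogonal_null_space:
  assumes "J \<in> functional_class" "q \<in> subdiff J v"
  shows "q \<in> (null_space J)\<^sup>\<bottom>"
proof -
  have "q \<bullet> w = 0" if "w \<in> null_space J" for w
  proof -
    have "- w \<in> null_space J" using null_space_subspace[OF assms(1)] that by (simp add: subspace_neg)
    then have "J w = 0" "J (- w) = 0" using that by (auto simp: null_space_def)
    moreover have "ereal (q \<bullet> w) \<le> J w" "ereal (q \<bullet> (- w)) \<le> J (- w)"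
      using assms(2) unfolding subdiff_def by blast+
    ultimately show ?thesis by auto
  qed
  then show ?thesis by (simp add: orthogonal_comp_def orthogonal_def inner_commute)
qed

section \<open>Gradient flows whose velocities are eigenvectors\<close>

locale eigenvector_flow =
  fixes J :: "'a::{real_inner, complete_space} \<Rightarrow> ereal" and u p :: "real \<Rightarrow> 'a"
  assumes functional: "J \<in> functional_class"
    and flow: "gradient_flow J (u 0) u p"
    and eigenvector: "\<And>t. 0 < t \<Longrightarrow> p t \<in> subdiff J (p t)"
begin

lemma speed_subgradient: "0 < t \<Longrightarrow> p t \<in> subdiff J (u t)"
  using flow by (auto simp: gradient_flow_def is_arg_min_def)

lemma speed_inner_le: "0 < t \<Longrightarrow> ereal (p t \<bullet> v) \<le> J v"
  using speed_subgradient by (auto simp: subdiff_def)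

lemma functional_along_flow: "0 < t \<Longrightarrow> J (u t) = ereal (p t \<bullet> u t)"
  using speed_subgradient[of t] unfolding subdiff_def by simp

lemma functional_at_speed: "0 < t \<Longrightarrow> J (p t) = ereal (p t \<bullet> p t)"
  using eigenvector[of t] unfolding subdiff_def by simp

lemma speed_flow_le: "0 < a \<Longrightarrow> 0 < b \<Longrightarrow> p a \<bullet> u b \<le> p b \<bullet> u b"
  using speed_inner_le[of a "u b"] functional_along_flow[of b] by simp

lemma speed_speed_le: "0 < a \<Longrightarrow> 0 < b \<Longrightarrow> p a \<bullet> p b \<le> p b \<bullet> p b"
  using speed_inner_le[of a "p b"] functional_at_speed[of b] by simp

lemma flow_continuous: "0 \<le> a \<Longrightarrow> continuous_on {a..b} u"
  using flow by (auto simp: gradient_flow_def intro: continuous_on_subset)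

lemma flow_tendsto:
  assumes "0 < t"
  shows "(u \<longlongrightarrow> u t) (at t)"
proof -
  have "continuous_on {0<..<t + 1} u" using flow_continuous[of 0 "t + 1"] by (rule continuous_on_subset) auto
  then show ?thesis using assms by (simp add: continuous_on_eq_continuous_at isCont_def)
qed

lemma flow_right_quotient:
  assumes "0 < t"
  shows "((\<lambda>y. (u y - u t) /\<^sub>R (y - t)) \<longlongrightarrow> - p t) (at_right t)"
proof -
  have "(u has_vector_derivative - p t) (at_right t)" using flow assms by (simp add: gradient_flow_def)
  then have "((\<lambda>y. (1 / norm (y - t)) *\<^sub>R (u y - (u t + (y - t) *\<^sub>R - p t))) \<longlongrightarrow> 0) (at_right t)"
    unfolding has_vector_derivative_def has_derivative_within by blast
  from tendsto_add[OF this tendsto_const[of "- p t"]]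
  have lim: "((\<lambda>y. (1 / norm (y - t)) *\<^sub>R (u y - (u t + (y - t) *\<^sub>R - p t)) + - p t) \<longlongrightarrow> - p t) (at_right t)"
    by simp
  have "\<forall>\<^sub>F y in at_right t.
    (1 / norm (y - t)) *\<^sub>R (u y - (u t + (y - t) *\<^sub>R - p t)) + - p t = (u y - u t) /\<^sub>R (y - t)"
    using eventually_at_right_less[of t]
  proof eventually_elim
    case (elim y)
    define h where "h = y - t"
    have "0 < h" using elim by (simp add: h_def)
    then show ?case unfolding h_def[symmetric]
      by (simp add: scaleR_diff_right scaleR_add_right inverse_eq_divide)
  qed
  then show ?thesis using lim by (rule Lim_transform_eventually[rotated])
qed

lemma inner_increment_le:
  assumes "0 \<le> a" "a \<le> b" and bound: "\<And>r. a < r \<Longrightarrow> r < b \<Longrightarrow> p r \<bullet> v \<le> c"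
  shows "(u a - u b) \<bullet> v \<le> c * (b - a)"
proof -
  have "- (u b \<bullet> v) - - (u a \<bullet> v) \<le> c * (b - a)"
  proof (rule increment_le_if_right_derivative_le[OF assms(2)])
    show "continuous_on {a..b} (\<lambda>x. - (u x \<bullet> v))" by (intro continuous_intros flow_continuous assms(1))
    fix x assume x: "a < x" "x < b"
    have "((\<lambda>y. - (((u y - u x) /\<^sub>R (y - x)) \<bullet> v)) \<longlongrightarrow> - (- p x \<bullet> v)) (at_right x)"
      using x assms(1) by (intro tendsto_intros flow_right_quotient) auto
    then show "((\<lambda>x. - (u x \<bullet> v)) has_real_derivative p x \<bullet> v) (at_right x)"
      by (simp add: has_field_derivative_iff inner_diff_left divide_inverse right_diff_distrib mult.commute minus_diff_commute)
    show "p x \<bullet> v \<le> c" using bound x by blast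
  qed
  then show ?thesis by (simp add: inner_diff_left)
qed

lemma inner_increment_ge:
  assumes "0 \<le> a" "a \<le> b" and "\<And>r. a < r \<Longrightarrow> r < b \<Longrightarrow> c \<le> p r \<bullet> v"
  shows "c * (b - a) \<le> (u a - u b) \<bullet> v"
  using inner_increment_le[OF assms(1,2), of "- v" "- c"] assms(3) by simp

lemma speed_bounded:
  assumes "0 < d"
  obtains L where "0 \<le> L" "lipschitz_on L {d..} u" "\<And>t. d \<le> t \<Longrightarrow> norm (p t) \<le> L"
proof -
  obtain L where L: "lipschitz_on L {d..} u" using flow assms by (auto simp: gradient_flow_def)
  have "norm (p t) \<le> L" if "d \<le> t" for t
  proof -
    have "0 < t" using that assms by simp
    have "\<forall>\<^sub>F y in at_right t. norm ((u y - u t) /\<^sub>R (y - t)) \<le> L"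
      using eventually_at_right_less[of t]
    proof eventually_elim
      case (elim y)
      then have "norm (u y - u t) \<le> L * (y - t)"
        using lipschitz_onD[OF L, of y t] that by (simp add: dist_norm)
      moreover have "norm ((u y - u t) /\<^sub>R (y - t)) = norm (u y - u t) / (y - t)"
        using elim by (simp add: divide_inverse mult.commute)
      ultimately show ?case using elim by (simp add: pos_divide_le_eq)
    qed
    then have "norm (- p t) \<le> L"
      by (intro tendsto_upperbound[OF tendsto_norm[OF flow_right_quotient[OF \<open>0 < t\<close>]]]) auto
    then show ?thesis by simp
  qed
  then show thesis using that L lipschitz_on_nonneg[OF L] by blast
qed

text \<open>The velocity \<open>p\<close> is a right derivative and need not a priori be right continuous. In place of
  continuity it suffices that, arbitrarily soon after \<open>x\<close>, there are times at which \<open>p\<close> has almost the full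
  component along \<open>p x\<close>: otherwise the mean value inequality would make the displacement from \<open>u x\<close>
  in that direction too small for the right derivative at \<open>x\<close> to be \<open>- p x\<close>.\<close>

lemma speed_near:
  assumes "0 < x" "0 < k" "0 < e"
  shows "\<exists>r. x < r \<and> r < x + k \<and> p x \<bullet> p x - e < p r \<bullet> p x"
proof (rule ccontr)
  assume contra: "\<not> ?thesis"
  have "\<forall>\<^sub>F y in at_right x. - (((u y - u x) /\<^sub>R (y - x)) \<bullet> p x) \<le> p x \<bullet> p x - e"
    using eventually_at_right_real[of x "x + k"] 
  proof (rule eventually_mono)
    fix y assume y: "y \<in> {x<..<x + k}"
    then have "(u x - u y) \<bullet> p x \<le> (p x \<bullet> p x - e) * (y - x)"
    proof (intro inner_increment_le)
      fix r assume "x < r" "r < y"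
      then show "p r \<bullet> p x \<le> p x \<bullet> p x - e" using contra y by (meson not_less greaterThanLessThan_iff less_trans)
    qed (use y assms in auto)
    moreover have "- (((u y - u x) /\<^sub>R (y - x)) \<bullet> p x) = ((u x - u y) \<bullet> p x) / (y - x)"
      by (simp add: inner_diff_left divide_inverse right_diff_distrib mult.commute)
    ultimately show "- (((u y - u x) /\<^sub>R (y - x)) \<bullet> p x) \<le> p x \<bullet> p x - e"
      using y by (simp add: pos_divide_le_eq)
  qed (use assms in simp)
  moreover have "((\<lambda>y. - (((u y - u x) /\<^sub>R (y - x)) \<bullet> p x)) \<longlongrightarrow> - (- p x \<bullet> p x)) (at_right x)"
    using assms by (intro tendsto_intros flow_right_quotient)
  ultimately have "- (- p x \<bullet> p x) \<le> p x \<bullet> p x - e" by (intro tendsto_upperbound) auto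
  then show False using assms by simp
qed

text \<open>Here \<open>J (u r) = p r \<bullet> u r\<close>, so the claim is that the nonnegative gap \<open>p r \<bullet> u r - p t \<bullet> u r\<close> stays
  zero after time \<open>t\<close>. The subgradient inequality bounds the increment of the gap from \<open>x\<close> to \<open>r\<close> by
  \<open>(p r - p t) \<bullet> (u r - u x)\<close>, that is, by about \<open>(r - x) (p t \<bullet> p x - p r \<bullet> p x)\<close>. For the times \<open>r\<close> of
  \<open>speed_near\<close> this is nearly \<open>(r - x) (p t \<bullet> p x - p x \<bullet> p x) \<le> 0\<close>, by the eigenvector property of
  \<open>p x\<close>.\<close>

lemma functional_linear_along_flow:
  assumes "0 < t" "t \<le> s"
  shows "p t \<bullet> u s = p s \<bullet> u s"
proof (rule antisym)
  show "p t \<bullet> u s \<le> p s \<bullet> u s" using assms by (intro speed_flow_le) auto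
  obtain L where L: "0 \<le> L" "lipschitz_on L {t..} u" "\<And>r. t \<le> r \<Longrightarrow> norm (p r) \<le> L"
    using speed_bounded[OF assms(1)] by blast
  have diff: "p a \<bullet> u a - p b \<bullet> u b \<le> L * L * \<bar>a - b\<bar>" if "t \<le> a" "t \<le> b" for a b
  proof -
    have "p a \<bullet> u a - p b \<bullet> u b \<le> p a \<bullet> (u a - u b)"
      using speed_flow_le[of a b] that assms by (simp add: inner_diff_right)
    also have "\<dots> \<le> norm (p a) * norm (u a - u b)" by (rule norm_cauchy_schwarz)
    also have "\<dots> \<le> L * (L * \<bar>a - b\<bar>)"
      using L that lipschitz_onD[OF L(2), of a b] by (intro mult_mono) (auto simp: dist_norm)
    finally show ?thesis by (simp add: mult.assoc)
  qed
  have "lipschitz_on (L * L) {t..s} (\<lambda>r. p r \<bullet> u r)"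
  proof (rule lipschitz_onI)
    fix a b assume "a \<in> {t..s}" "b \<in> {t..s}"
    then show "dist (p a \<bullet> u a) (p b \<bullet> u b) \<le> L * L * dist a b"
      using diff[of a b] diff[of b a] by (simp add: dist_real_def abs_le_iff abs_minus_commute)
  qed (use L(1) in simp)
  then have cont: "continuous_on {t..s} (\<lambda>r. p r \<bullet> u r - p t \<bullet> u r)"
    using assms
    by (intro continuous_on_diff continuous_on_inner continuous_on_const flow_continuous
          lipschitz_on_continuous_on[of "L * L" _ "\<lambda>r. p r \<bullet> u r"]) auto
  have "p s \<bullet> u s - p t \<bullet> u s \<le> p t \<bullet> u t - p t \<bullet> u t"
  proof (rule nonincreasing_if_lower_right_dini_nonpos[OF assms(2) cont])
    fix x e d :: real assume x: "t < x" "x < s" and "0 < e" "0 < d"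
    \<comment> \<open>The error consists of \<open>e'\<close> from the choice of \<open>r\<close> and of at most \<open>2 * L * e'\<close> from replacing
      the difference quotient by \<open>- p x\<close>.\<close>
    define e' where "e' = e / (2 * L + 2)"
    have e': "0 < e'" "e' * (2 * L + 1) \<le> e" using L(1) \<open>0 < e\<close> by (auto simp: e'_def field_simps)
    have "\<forall>\<^sub>F y in at_right x. norm ((u y - u x) /\<^sub>R (y - x) + p x) < e'"
      using tendstoD[OF flow_right_quotient[of x] e'(1)] x assms by (simp add: dist_norm)
    then obtain b where b: "x < b" "\<And>y. x < y \<Longrightarrow> y < b \<Longrightarrow> norm ((u y - u x) /\<^sub>R (y - x) + p x) < e'"
      unfolding eventually_at_right_field by blast
    obtain r where r: "x < r" "r < x + min d (b - x)" "p x \<bullet> p x - e' < p r \<bullet> p x"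
      using speed_near[of x "min d (b - x)" e'] x assms b \<open>0 < d\<close> e' by auto
    \<comment> \<open>The deviation of the difference quotient of \<open>u\<close> from its limit \<open>- p x\<close>.\<close>
    define q where "q = (u r - u x) /\<^sub>R (r - x) + p x"
    have q: "norm q \<le> e'" using b(2)[of r] r unfolding q_def by (auto intro: less_imp_le)
    have incr: "u r - u x = (r - x) *\<^sub>R (q - p x)" using r by (simp add: q_def)
    have "(p r - p t) \<bullet> q \<le> norm (p r - p t) * norm q" by (rule norm_cauchy_schwarz)
    also have "\<dots> \<le> (L + L) * e'"
      using L(3)[of r] L(3)[of t] r x q L(1) norm_triangle_ineq4[of "p r" "p t"]
      by (intro mult_mono) auto
    finally have "(p r - p t) \<bullet> (q - p x) \<le> (L + L) * e' + e'"
      using r(3) speed_speed_le[of t x] x assms by (simp add: inner_diff_left inner_diff_right)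
    also have "\<dots> \<le> e" using e'(2) by (simp add: algebra_simps)
    finally have slope: "(p r - p t) \<bullet> (q - p x) \<le> e" .
    have "(p r \<bullet> u r - p t \<bullet> u r) - (p x \<bullet> u x - p t \<bullet> u x) \<le> (p r - p t) \<bullet> (u r - u x)"
      using speed_flow_le[of r x] x r assms by (simp add: inner_diff_left inner_diff_right)
    also have "\<dots> = (r - x) * ((p r - p t) \<bullet> (q - p x))" by (simp add: incr)
    also have "\<dots> \<le> (r - x) * e" using slope r by (intro mult_left_mono) auto
    finally show "\<exists>h. 0 < h \<and> h < d \<and> p (x + h) \<bullet> u (x + h) - p t \<bullet> u (x + h)
        \<le> p x \<bullet> u x - p t \<bullet> u x + e * h"
      using r by (intro exI[of _ "r - x"]) (auto simp: mult.commute)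
  qed
  then show "p s \<bullet> u s \<le> p t \<bullet> u s" by simp
qed

text \<open>The linear form \<open>(p s - p t) \<bullet> _\<close> vanishes on \<open>u y\<close> for all \<open>y \<ge> t\<close>, so it vanishes on the right
  derivative of \<open>u\<close> at \<open>t\<close>.\<close>

lemma speed_inner_speed:
  assumes "0 < s" "s \<le> t"
  shows "p s \<bullet> p t = p t \<bullet> p t"
proof -
  have lim: "((\<lambda>y. ((u y - u t) /\<^sub>R (y - t)) \<bullet> (p s - p t)) \<longlongrightarrow> - p t \<bullet> (p s - p t)) (at_right t)"
    using assms by (intro tendsto_intros flow_right_quotient) auto
  have "\<forall>\<^sub>F y in at_right t. ((u y - u t) /\<^sub>R (y - t)) \<bullet> (p s - p t) = 0"
    using eventually_at_right_less[of t]
  proof eventually_elim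
    case (elim y)
    then have "p s \<bullet> u y = p t \<bullet> u y" "p s \<bullet> u t = p t \<bullet> u t"
      using functional_linear_along_flow[of s y] functional_linear_along_flow[of t y]
        functional_linear_along_flow[of s t] assms by auto
    then show ?case by (simp add: inner_diff_left inner_diff_right inner_commute)
  qed
  then have "- p t \<bullet> (p s - p t) = 0"
    by (intro tendsto_unique[OF trivial_limit_at_right_real lim] tendsto_eventually)
  then show ?thesis by (simp add: inner_diff_right inner_commute)
qed

end

section \<open>Extinction in finite time\<close>

locale extinguishing_eigenvector_flow = eigenvector_flow +
  fixes T :: real
  assumes projection_zero: "null_proj J (u 0) = 0"
    and extinction: "extinction_time J (u 0) u = ereal T"
    and T_pos: "0 < T"
begin

text \<open>The extinction time is an infimum of zeros of \<open>u\<close>, and by continuity it is itself a zero.\<close>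

lemma flow_extinct: "u T = 0"
proof -
  have "\<exists>t. T \<le> t \<and> t < T + e \<and> u t = 0" if "0 < e" for e
  proof -
    have inf: "Inf (ereal ` {t. 0 < t \<and> u t = 0}) = ereal T"
      using extinction projection_zero by (simp add: extinction_time_def)
    then have "Inf (ereal ` {t. 0 < t \<and> u t = 0}) < ereal (T + e)" using that by simp
    then obtain t where t: "0 < t" "u t = 0" "t < T + e" by (auto simp: Inf_less_iff)
    then have "Inf (ereal ` {t. 0 < t \<and> u t = 0}) \<le> ereal t" by (intro Inf_lower) auto
    then have "T \<le> t" unfolding inf by simp
    then show ?thesis using t by auto
  qed
  note near = this
  show ?thesis
  proof (rule ccontr)
    assume "u T \<noteq> 0"
    then have "\<forall>\<^sub>F t in at T. u t \<noteq> 0"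
      by (rule tendsto_imp_eventually_ne[OF flow_tendsto[OF T_pos]])
    then obtain d where d: "0 < d" "\<And>t. t \<noteq> T \<Longrightarrow> dist t T < d \<Longrightarrow> u t \<noteq> 0"
      unfolding eventually_at by auto
    obtain t where "T \<le> t" "t < T + d" "u t = 0" using near[OF d(1)] by blast
    then show False using d(2)[of t] \<open>u T \<noteq> 0\<close> by (cases "t = T") (auto simp: dist_real_def)
  qed
qed

lemma flow_nonzero: "0 < t \<Longrightarrow> t < T \<Longrightarrow> u t \<noteq> 0"
proof
  assume "0 < t" "t < T" "u t = 0"
  then have "extinction_time J (u 0) u \<le> ereal t"
    unfolding extinction_time_def projection_zero by (intro Inf_lower) auto
  then show False using extinction \<open>t < T\<close> by simp
qed

lemma initial_datum_orthogonal: "u 0 \<in> (null_space J)\<^sup>\<bottom>"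
  using orthogonal_projection_properties[OF null_space_subspace null_space_closed, OF functional functional, of "u 0"]
    projection_zero by simp

text \<open>The velocities are orthogonal to the null space, so the component of the flow in it is conserved.\<close>

lemma flow_orthogonal:
  assumes "0 \<le> t" "v \<in> null_space J"
  shows "u t \<bullet> v = 0"
proof -
  have orth: "q \<bullet> v = 0" if "q \<in> (null_space J)\<^sup>\<bottom>" for q
    using that assms(2) by (auto simp: orthogonal_comp_def orthogonal_def inner_commute)
  have "p r \<bullet> v = 0" if "0 < r" for r
    using subgradient_orthogonal_null_space[OF functional speed_subgradient[OF that]] by (rule orth)
  then have "(u 0 - u t) \<bullet> v = 0"
    using inner_increment_le[of 0 t v 0] inner_increment_ge[of 0 t 0 v] assms(1) by force
  then show ?thesis using orth[OF initial_datum_orthogonal] by (simp add: inner_diff_left)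
qed

text \<open>If the velocity vanished, \<open>J (u t)\<close> would be zero, and \<open>u t\<close> would lie both in the null space and in
  its orthogonal complement.\<close>

lemma speed_nonzero:
  assumes "0 < t" "t < T"
  shows "p t \<noteq> 0"
proof
  assume "p t = 0"
  then have "u t \<in> null_space J" using functional_along_flow[OF assms(1)] by (simp add: null_space_def zero_ereal_def)
  then have "u t \<bullet> u t = 0" using flow_orthogonal[of t "u t"] assms(1) by simp
  then show False using flow_nonzero[OF assms] by simp
qed

text \<open>Integration of \<open>p r \<bullet> v \<le> J v\<close> over \<open>[t, T]\<close>.\<close>

lemma flow_inner_le:
  assumes "0 \<le> t" "t \<le> T" "J v = ereal c"
  shows "u t \<bullet> v \<le> (T - t) * c"
  using inner_increment_le[of t T v c] speed_inner_le[of _ v] assms flow_extinct by (simp add: mult.commute)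

text \<open>The upper bound is \<open>flow_inner_le\<close> at time zero. For the lower bound the velocity \<open>p t\<close> serves as
  test vector: on \<open>[0, t]\<close> all velocities have the same inner product \<open>p t \<bullet> p t = J (p t)\<close> with it, so
  \<open>u 0 \<bullet> p t = t * J (p t) + J (u t)\<close> and the quotient is at least \<open>t\<close>.\<close>

lemma extinction_time_eq_dual_norm:
  "ereal T = (SUP q \<in> (null_space J)\<^sup>\<bottom> - {0}. ereal (u 0 \<bullet> q) / J q)"
proof (rule antisym)
  show "(SUP q \<in> (null_space J)\<^sup>\<bottom> - {0}. ereal (u 0 \<bullet> q) / J q) \<le> ereal T"
  proof (rule SUP_least)
    fix q assume q: "q \<in> (null_space J)\<^sup>\<bottom> - {0}"
    have "q \<notin> null_space J"
    proof
      assume "q \<in> null_space J"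
      then have "q \<bullet> q = 0" using q by (auto simp: orthogonal_comp_def orthogonal_def)
      then show False using q by simp
    qed
    then have "J q \<noteq> 0" by (simp add: null_space_def)
    then have pos: "0 < J q" using functional_class_nonneg[OF functional, of q] by (simp add: order_less_le)
    show "ereal (u 0 \<bullet> q) / J q \<le> ereal T"
    proof (cases "J q")
      case (real c)
      then have "0 < c" using pos by simp
      then show ?thesis using real flow_inner_le[of 0 q c] T_pos by (simp add: field_simps)
    qed (use pos T_pos in auto)
  qed
  show "ereal T \<le> (SUP q \<in> (null_space J)\<^sup>\<bottom> - {0}. ereal (u 0 \<bullet> q) / J q)" (is "_ \<le> ?S")
  proof (rule dense_le_bounded)
    show "0 < ereal T" using T_pos by simp
    fix y assume "0 < y" "y < ereal T"
    then obtain t where t: "y = ereal t" "0 < t" "t < T" by (cases y) auto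
    have "p t \<bullet> p t * (t - 0) \<le> (u 0 - u t) \<bullet> p t"
    proof (rule inner_increment_ge)
      fix r assume "0 < r" "r < t"
      then show "p t \<bullet> p t \<le> p r \<bullet> p t" using speed_inner_speed[of r t] by simp
    qed (use t in auto)
    moreover have "0 \<le> u t \<bullet> p t"
      using functional_class_nonneg[OF functional, of "u t"] functional_along_flow[OF t(2)] by (simp add: inner_commute)
    ultimately have le: "t * (p t \<bullet> p t) \<le> u 0 \<bullet> p t" by (simp add: inner_diff_left mult.commute)
    have "0 < p t \<bullet> p t" using speed_nonzero[OF t(2,3)] by simp
    then have "y \<le> ereal (u 0 \<bullet> p t) / J (p t)"
      using le t by (simp add: functional_at_speed field_simps)
    also have "\<dots> \<le> ?S"
      using subgradient_orthogonal_null_space[OF functional speed_subgradient[OF t(2)]] speed_nonzero[OF t(2,3)]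
      by (intro SUP_upper) auto
    finally show "y \<le> ?S" .
  qed
qed

end

section \<open>Weak limits of the extinction profile\<close>

locale weak_extinction_profile = extinguishing_eigenvector_flow J u p T
  for J :: "'a::{real_inner, complete_space} \<Rightarrow> ereal" and u p :: "real \<Rightarrow> 'a" and T :: real +
  fixes s :: "nat \<Rightarrow> real" and pstar :: 'a
  assumes times_before: "\<And>n. s n < T"
    and times_tendsto: "s \<longlonglongrightarrow> T"
    and profile_weak: "weakly_converges_to (\<lambda>n. extinction_profile T u (s n)) pstar"
begin

lemma eventually_times_after: "t < T \<Longrightarrow> \<forall>\<^sub>F n in sequentially. t < s n"
  using times_tendsto by (rule order_tendstoD(1))

lemma profile_inner_tendsto: "(\<lambda>n. v \<bullet> extinction_profile T u (s n)) \<longlonglongrightarrow> v \<bullet> pstar"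
  unfolding inner_commute[of v] using profile_weak by (simp add: weakly_converges_to_def)

lemma profile_inner:
  "0 < s n \<Longrightarrow> v \<bullet> extinction_profile T u (s n) = (u (s n) \<bullet> v) / (T - s n)"
  using times_before[of n] by (simp add: extinction_profile_def inner_commute divide_inverse mult.commute)

lemma functional_profile:
  assumes "0 < t" "t \<le> s n"
  shows "J (extinction_profile T u (s n)) = ereal (p t \<bullet> extinction_profile T u (s n))"
proof -
  have "J (extinction_profile T u (s n)) = ereal \<bar>inverse (T - s n)\<bar> * J (u (s n))"
    using functional_classD(3)[OF functional, of "inverse (T - s n)" "u (s n)"] assms times_before[of n]
    by (simp add: extinction_profile_def)
  then show ?thesis
    using functional_along_flow[of "s n"] functional_linear_along_flow[of t "s n"] assms times_before[of n]
    by (simp add: extinction_profile_def)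
qed

text \<open>The profile is a positive multiple of \<open>u (s n)\<close>, so \<open>functional_linear_along_flow\<close> says that \<open>J\<close>
  agrees on the profiles after time \<open>t\<close> with the linear form \<open>p t \<bullet> _\<close>. Weak lower semicontinuity
  gives one inequality and domination of \<open>p t\<close> by \<open>J\<close> the other.\<close>

lemma functional_limit:
  assumes "0 < t" "t < T"
  shows "J pstar = ereal (p t \<bullet> pstar)"
proof (rule antisym)
  show "J pstar \<le> ereal (p t \<bullet> pstar)"
  proof (rule functional_class_weak_lower_bound[OF functional profile_weak _ profile_inner_tendsto])
    show "\<forall>\<^sub>F n in sequentially. J (extinction_profile T u (s n)) = ereal (p t \<bullet> extinction_profile T u (s n))"
      using eventually_times_after[OF assms(2)]
      by eventually_elim (use assms in \<open>simp add: functional_profile\<close>)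
  qed
  show "ereal (p t \<bullet> pstar) \<le> J pstar" using assms by (intro speed_inner_le)
qed

lemma speed_subgradient_limit: "0 < t \<Longrightarrow> t < T \<Longrightarrow> p t \<in> subdiff J pstar"
  using functional_limit speed_inner_le by (auto simp: subdiff_def)

text \<open>Equality in \<open>flow_inner_le\<close>, since the velocity attains \<open>p r \<bullet> pstar = J pstar\<close> for all
  \<open>0 < r < T\<close>.\<close>

lemma flow_inner_limit:
  assumes "0 \<le> t" "t \<le> T" "J pstar = ereal c"
  shows "u t \<bullet> pstar = (T - t) * c"
proof (rule antisym)
  show "u t \<bullet> pstar \<le> (T - t) * c" using assms by (rule flow_inner_le)
  have "c * (T - t) \<le> (u t - u T) \<bullet> pstar"
  proof (rule inner_increment_ge)
    fix r assume "t < r" "r < T"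
    then show "c \<le> p r \<bullet> pstar" using functional_limit[of r] assms by simp
  qed (use assms in auto)
  then show "(T - t) * c \<le> u t \<bullet> pstar" by (simp add: flow_extinct mult.commute)
qed

lemma limit_inner_le: "ereal (pstar \<bullet> v) \<le> J v"
proof (cases "J v")
  case (real c)
  have "\<forall>\<^sub>F n in sequentially. v \<bullet> extinction_profile T u (s n) \<le> c"
    using eventually_times_after[OF T_pos]
  proof eventually_elim
    case (elim n)
    then show ?case using flow_inner_le[OF _ _ real, of "s n"] times_before[of n]
      by (simp add: profile_inner field_simps)
  qed
  then have "v \<bullet> pstar \<le> c" by (intro tendsto_upperbound[OF profile_inner_tendsto]) auto
  then show ?thesis using real by (simp add: inner_commute)
qed (use functional_classD(1)[OF functional, of v] in auto)

lemma functional_limit_real: "\<exists>c. J pstar = ereal c"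
  using functional_limit[of "T / 2"] T_pos by auto

text \<open>By \<open>flow_inner_limit\<close> the profiles at positive times all have the same inner product \<open>J pstar\<close> with \<open>pstar\<close>, which is then
  also the inner product of their weak limit with \<open>pstar\<close>.\<close>

lemma functional_at_limit: "J pstar = ereal (pstar \<bullet> pstar)"
proof -
  obtain c where c: "J pstar = ereal c" using functional_limit_real by blast
  have "\<forall>\<^sub>F n in sequentially. pstar \<bullet> extinction_profile T u (s n) = c"
    using eventually_times_after[OF T_pos]
  proof eventually_elim
    case (elim n)
    then show ?case using flow_inner_limit[OF _ _ c, of "s n"] times_before[of n]
      by (simp add: profile_inner)
  qed
  then have "(\<lambda>n. pstar \<bullet> extinction_profile T u (s n)) \<longlonglongrightarrow> c" by (rule tendsto_eventually)
  then show ?thesis using LIMSEQ_unique[OF profile_inner_tendsto] c by blast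
qed

lemma limit_eigenvector: "pstar \<in> subdiff J pstar"
  using limit_inner_le functional_at_limit by (simp add: subdiff_def)

lemma extinction_time_eq_quotient:
  assumes "pstar \<noteq> 0"
  shows "ereal T = ereal (u 0 \<bullet> pstar) / J pstar"
  using assms flow_inner_limit[OF _ _ functional_at_limit, of 0] T_pos by (simp add: functional_at_limit)

text \<open>The estimate \<open>norm (u r) \<le> C * (p r \<bullet> u r)\<close> and Cauchy--Schwarz give \<open>norm (p r) \<ge> 1 / C\<close>. For a fixed
  \<open>t\<close> the number \<open>p t \<bullet> w (s n)\<close> is the average of \<open>p r \<bullet> p t = p r \<bullet> p r\<close> over \<open>[s n, T]\<close>, hence at
  least \<open>1 / C\<^sup>2\<close>, and this bound survives the weak limit.\<close>

lemma limit_nonzero: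
  assumes "0 < C" and bound: "\<And>t. 0 < t \<Longrightarrow> ereal (norm (u t)) \<le> ereal C * J (u t)"
  shows "pstar \<noteq> 0"
proof -
  \<comment> \<open>Any time strictly between \<open>0\<close> and \<open>T\<close> would do.\<close>
  define t where "t = T / 2"
  have t: "0 < t" "t < T" using T_pos by (auto simp: t_def)
  have speed: "(1 / C)\<^sup>2 \<le> p r \<bullet> p r" if r: "0 < r" "r < T" for r
  proof -
    have "norm (u r) \<le> C * (p r \<bullet> u r)" using bound[OF r(1)] functional_along_flow[OF r(1)] by simp
    also have "\<dots> \<le> C * (norm (p r) * norm (u r))"
      using \<open>0 < C\<close> by (intro mult_left_mono norm_cauchy_schwarz) auto
    finally have "1 / C \<le> norm (p r)" using \<open>0 < C\<close> flow_nonzero[OF r] by (simp add: field_simps)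
    then have "(1 / C)\<^sup>2 \<le> (norm (p r))\<^sup>2" using \<open>0 < C\<close> by (intro power_mono) auto
    then show ?thesis by (simp add: power2_norm_eq_inner)
  qed
  have "\<forall>\<^sub>F n in sequentially. (1 / C)\<^sup>2 \<le> p t \<bullet> extinction_profile T u (s n)"
    using eventually_times_after[OF t(2)]
  proof eventually_elim
    case (elim n)
    have "(1 / C)\<^sup>2 * (T - s n) \<le> (u (s n) - u T) \<bullet> p t"
    proof (rule inner_increment_ge)
      fix r assume "s n < r" "r < T"
      then show "(1 / C)\<^sup>2 \<le> p r \<bullet> p t"
        using speed[of r] speed_inner_speed[of t r] elim t by (simp add: inner_commute)
    qed (use elim t times_before[of n] in auto)
    then show ?case using elim t times_before[of n] by (simp add: profile_inner flow_extinct field_simps)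
  qed
  then have "(1 / C)\<^sup>2 \<le> p t \<bullet> pstar" by (intro tendsto_lowerbound[OF profile_inner_tendsto]) auto
  then show ?thesis using \<open>0 < C\<close> by auto
qed

end

theorem theorem6p17:
  fixes J :: "'a::{real_inner, complete_space} \<Rightarrow> ereal"
    and f pstar :: 'a
    and u p :: "real \<Rightarrow> 'a"
    and T :: real
    and s :: "nat \<Rightarrow> real"
  assumes "J \<in> functional_class"
    and "f \<in> closure (dom_subdiff J)"
    and "gradient_flow J f u p"
    and "null_proj J f = 0"
    and "\<forall>t>0. p t \<in> subdiff J (p t)"
    and "extinction_time J f u = ereal T" and "0 < T"
    and "incseq s" and "\<forall>n. s n < T" and "s \<longlonglongrightarrow> T"
    and "weakly_converges_to (\<lambda>n. extinction_profile T u (s n)) pstar"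
  shows "((\<exists>C>0. \<forall>t>0. ereal (norm (u t - null_proj J f)) \<le> ereal C * J (u t)) \<longrightarrow> pstar \<noteq> 0) \<and>
         (\<forall>t. 0 < t \<and> t < T \<longrightarrow> p t \<in> subdiff J pstar) \<and>
         pstar \<in> subdiff J pstar \<and>
         (pstar \<noteq> 0 \<longrightarrow> ereal T = ereal (f \<bullet> pstar) / J pstar) \<and>
         ereal T = (SUP q \<in> (null_space J)\<^sup>\<bottom> - {0}. ereal (f \<bullet> q) / J q)"
proof -
  have init: "u 0 = f" using assms(3) by (simp add: gradient_flow_def)
  interpret weak_extinction_profile J u p T s pstar
    using assms by unfold_locales (auto simp: init)
  show ?thesis
    using limit_nonzero speed_subgradient_limit limit_eigenvector extinction_time_eq_quotient
      extinction_time_eq_dual_norm assms(4)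
    unfolding init by auto
qed

end
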